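(* For every $K_3N$ $n=pqr$, $$p\le\left\lceil\sqrt[3]{n}-\frac{4\sqrt3}{9}\sqrt[6]{n}\right\rceil .$$
   Context: A $K_3N$ (Korselt number with three factors) is an integer $n$ together with a factorisation $n=pqr$, where $1<p<q<r$ are odd integers (not necessarily prime) such that each of $p-1,\ q-1,\ r-1$ divides $n-1$, and such that $E:=\dfrac{pq-1}{r-1}$ (which is an integer by the divisibility condition) satisfies $E\ge 2$. *)

theory Defs
  imports Complex_Main
begin

text \<open>
  The cofactor \<open>E = (p q - 1) / (r - 1)\<close>. The integer division is exact under the
  divisibility condition \<open>r - 1 dvd p q r - 1\<close>; see \<open>korselt_cofactor_exact\<close> below.
\<close>
definition korselt_cofactor :: "int \<Rightarrow> int \<Rightarrow> int \<Rightarrow> int" where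
  "korselt_cofactor p q r = (p * q - 1) div (r - 1)"

text \<open>
  A number \<open>n\<close> together with its factorisation \<open>n = p q r\<close>; the factors need not be prime.
\<close>
definition K3N :: "int \<Rightarrow> int \<Rightarrow> int \<Rightarrow> int \<Rightarrow> bool" where
  "K3N n p q r \<longleftrightarrow>
     n = p * q * r \<and>
     1 < p \<and> p < q \<and> q < r \<and>
     odd p \<and> odd q \<and> odd r \<and>
     (p - 1) dvd (n - 1) \<and> (q - 1) dvd (n - 1) \<and> (r - 1) dvd (n - 1) \<and>
     korselt_cofactor p q r \<ge> 2"

lemma korselt_cofactor_exact:
  assumes "(r - 1) dvd (p * q * r - 1)"
  shows "korselt_cofactor p q r * (r - 1) = p * q - 1"
proof -
  have "p * q - 1 = (p * q * r - 1) - p * q * (r - 1)"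
    by (simp add: algebra_simps)
  with assms have "(r - 1) dvd (p * q - 1)"
    by (metis dvd_diff dvd_triv_right)
  then show ?thesis
    unfolding korselt_cofactor_def by (rule dvd_div_mult_self)
qed

end

theory Submission
  imports Defs
begin

text \<open>
  Only the divisibility by \<open>q - 1\<close> matters. Modulo \<open>q - 1\<close> it turns \<open>(q - p - 1) (r - q) + (q - p)\<close>
  into a positive multiple of \<open>q - 1\<close>, so \<open>u = q - p - 1\<close> and \<open>v = r - q\<close> satisfy
  \<open>u v \<ge> p - 1\<close>. By AM-GM, \<open>(q - p) + (r - p) = 2 u + v + 2\<close> is at least about
  \<open>2 \<surd>2 \<surd>p\<close>, which forces \<open>n\<^sup>1\<^sup>/\<^sup>3 \<ge> p + (4/5) \<surd>(p - 1)\<close>. As \<open>(4/5)\<^sup>2 > 16/27 = (4 \<surd>3 / 9)\<^sup>2\<close>,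
  this is enough.
\<close>

lemma K3N_gap_product:
  fixes n p q r :: int
  assumes "K3N n p q r"
  shows "p - 1 \<le> (q - p - 1) * (r - q)"
proof -
  have n: "n = p * q * r" and ord: "1 < p" "p < q" "q < r" and dvd: "q - 1 dvd n - 1"
    using assms by (auto simp: K3N_def)
  \<comment> \<open>Setting \<open>q\<close> to 1 modulo \<open>q - 1\<close>, the left side becomes
    \<open>-p * (r - 1) + (1 - p) = 1 - p * r\<close>, the residue of
    \<open>-(n - 1)\<close>.\<close>
  have "(q - p - 1) * (r - q) + (q - p) = (q - 1) * (r + p - q + 1 + p * r) - (n - 1)"
    unfolding n by (simp add: algebra_simps)
  then have "q - 1 dvd (q - p - 1) * (r - q) + (q - p)"
    using dvd by simp
  moreover have "0 < (q - p - 1) * (r - q) + (q - p)"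
    using ord by (intro add_nonneg_pos mult_nonneg_nonneg) auto
  ultimately have "q - 1 \<le> (q - p - 1) * (r - q) + (q - p)"
    by (rule zdvd_imp_le)
  then show ?thesis by simp
qed

lemma product_ge_cube:
  fixes P u v w :: real
  assumes P: "P = w\<^sup>2 + 1" and nonneg: "0 \<le> u" "0 \<le> v" "0 \<le> w" and uv: "w\<^sup>2 \<le> u * v"
  shows "(P + 4/5 * w) ^ 3 \<le> P * (P + (u + 1)) * (P + (u + 1 + v))"
proof -
  \<comment> \<open>14/5 is a rational stand-in for 2 \<open>sqrt 2\<close>: its square is 7.84 <
    8.\<close>
  have "(14/5 * w)\<^sup>2 \<le> 8 * (u * v)"
    using uv mult_nonneg_nonneg[OF nonneg(1,2)] by (simp add: power_mult_distrib power_divide)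
  also have "\<dots> \<le> (2 * u + v)\<^sup>2"
    using zero_le_power2[of "2 * u - v"] by (simp add: power2_eq_square algebra_simps)
  finally have sum: "14/5 * w \<le> 2 * u + v"
    using nonneg by (auto intro: power2_le_imp_le)
  have P0: "0 \<le> P" and wP: "w\<^sup>2 \<le> P" by (simp_all add: P)
  have "P\<^sup>2 + 2 * P + P * (14/5 * w) \<le> P\<^sup>2 + 2 * P + P * (2 * u + v)"
    using sum P0 by (intro add_left_mono mult_left_mono)
  also have "\<dots> \<le> (P + (u + 1)) * (P + (u + 1 + v))"
    using nonneg by (simp add: power2_eq_square algebra_simps)
  finally have "P * (P\<^sup>2 + 2 * P + P * (14/5 * w)) \<le> P * ((P + (u + 1)) * (P + (u + 1 + v)))"
    using P0 by (rule mult_left_mono)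
  \<comment> \<open>Beyond the first two terms of the cube there remain
    \<open>2 * P\<^sup>2 + 2/5 * w * P\<^sup>2\<close> to cover
    \<open>48/25 * P * w\<^sup>2 + 64/125 * w ^ 3\<close>. Here \<open>2 * P\<^sup>2\<close> pays
    for the first term, \<open>2/5 * w * P\<^sup>2\<close> for most of the second, and the leftover
    \<open>14/125 * w * P\<close> is at most \<open>7/125 * P\<^sup>2\<close>, below the unspent
    \<open>2/25 * P\<^sup>2\<close>.\<close>
  moreover have "P * w\<^sup>2 \<le> P * P" "w * w\<^sup>2 \<le> w * P"
    using wP P0 nonneg by (simp_all add: mult_left_mono)
  moreover have "w * P * 1 \<le> w * P * P"
    using P P0 nonneg by (intro mult_left_mono) auto
  moreover have "w * P \<le> P / 2 * P"
    using P0 zero_le_power2[of "w - 1"]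
    by (intro mult_right_mono) (simp_all add: P power2_eq_square algebra_simps)
  moreover have "(P + 4/5 * w) ^ 3
      = P ^ 3 + 12/5 * (w * P * P) + 48/25 * (P * w\<^sup>2) + 64/125 * (w * w\<^sup>2)"
    by (simp add: power2_eq_square power3_eq_cube field_simps)
  moreover have "P * (P\<^sup>2 + 2 * P + P * (14/5 * w)) = P ^ 3 + 2 * (P * P) + 14/5 * (w * P * P)"
    by (simp add: power2_eq_square power3_eq_cube field_simps)
  ultimately show ?thesis
    using zero_le_square[of P] unfolding mult.assoc by linarith
qed

text \<open>Since \<open>t\<^sup>2 - c * t\<close> increases for \<open>t \<ge> c / 2\<close>, only
  the least admissible \<open>z\<close>, called \<open>y\<close>, has to be checked.\<close>

lemma square_minus_linear_gt:
  fixes c w z :: real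
  assumes c: "0 \<le> c" "c\<^sup>2 = 16/27" and nonneg: "0 \<le> w" "0 \<le> z"
    and le: "w\<^sup>2 + 4/5 * w + 1 \<le> z\<^sup>2"
  shows "w\<^sup>2 < z\<^sup>2 - c * z"
proof -
  define y where "y = sqrt (w\<^sup>2 + 4/5 * w + 1)"
  have y2: "y\<^sup>2 = w\<^sup>2 + 4/5 * w + 1"
    using nonneg by (simp add: y_def)
  have y1: "1 \<le> y" and yz: "y \<le> z"
    using nonneg le by (auto simp: y_def intro: real_le_lsqrt)
  have "(c * y)\<^sup>2 = 16/27 * (w\<^sup>2 + 4/5 * w + 1)"
    by (simp add: power_mult_distrib c y2)
  also have "\<dots> < (4/5 * w + 1)\<^sup>2"
  proof -
    have "(4/5 * w + 1)\<^sup>2 = 16/25 * w\<^sup>2 + 8/5 * w + 1"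
      by (simp add: power2_eq_square field_simps)
    moreover have "16/27 * (w\<^sup>2 + 4/5 * w + 1) = 16/27 * w\<^sup>2 + 64/135 * w + 16/27"
      by simp
    moreover have "16/27 * w\<^sup>2 + 64/135 * w + 16/27 < 16/25 * w\<^sup>2 + 8/5 * w + 1"
      using nonneg zero_le_power2[of w] by linarith
    ultimately show ?thesis by simp
  qed
  finally have cy: "c * y < 4/5 * w + 1"
    using nonneg by (auto intro: power2_less_imp_less)
  have "c \<le> 1"
    by (rule power2_le_imp_le) (simp_all add: c)
  \<comment> \<open>This product is the increment of \<open>t\<^sup>2 - c * t\<close> from
    \<open>y\<close> to \<open>z\<close>.\<close>
  then have "0 \<le> (z - y) * (z + y - c)"
    using y1 yz by (intro mult_nonneg_nonneg) auto
  then have "y\<^sup>2 - c * y \<le> z\<^sup>2 - c * z"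
    by (simp add: power2_eq_square algebra_simps)
  then show ?thesis using cy y2 by simp
qed

theorem theorem4p6:
  fixes n p q r :: int
  assumes "K3N n p q r"
  shows "p \<le> \<lceil>root 3 (real_of_int n) - 4 * sqrt 3 / 9 * root 6 (real_of_int n)\<rceil>"
proof -
  have n: "n = p * q * r" and ord: "1 < p" "p < q" "q < r"
    using assms by (auto simp: K3N_def)
  define w where "w = sqrt (real_of_int (p - 1))"
  define z where "z = root 6 (real_of_int n)"
  have w: "0 \<le> w" "w\<^sup>2 = real_of_int (p - 1)"
    using ord by (simp_all add: w_def)
  have "0 \<le> n"
    using ord by (simp add: n)
  then have z: "0 \<le> z" "z ^ 6 = real_of_int n"
    by (simp_all add: z_def)
  have root3: "root 3 (real_of_int n) = z\<^sup>2"
    by (rule real_root_pos_unique) (simp_all add: z flip: power_mult)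
  have "real_of_int (p - 1) \<le> real_of_int ((q - p - 1) * (r - q))"
    using K3N_gap_product[OF assms] by (simp only: of_int_le_iff)
  then have "w\<^sup>2 \<le> real_of_int (q - p - 1) * real_of_int (r - q)"
    unfolding w(2) by (simp only: of_int_mult)
  then have "(real_of_int p + 4/5 * w) ^ 3
      \<le> real_of_int p * (real_of_int p + (real_of_int (q - p - 1) + 1))
        * (real_of_int p + (real_of_int (q - p - 1) + 1 + real_of_int (r - q)))"
    using ord w by (intro product_ge_cube) auto
  also have "\<dots> = real_of_int n" by (simp add: n)
  also have "\<dots> = (z\<^sup>2) ^ 3" by (simp add: z flip: power_mult)
  finally have "real_of_int p + 4/5 * w \<le> z\<^sup>2"
    by (rule power_le_imp_le_base[where n = 2, simplified]) simp
  then have "w\<^sup>2 + 4/5 * w + 1 \<le> z\<^sup>2" by (simp add: w(2))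
  \<comment> \<open>As \<open>w\<^sup>2 = p - 1\<close>, this strict bound is exactly what puts
    \<open>p\<close> below the ceiling.\<close>
  then have "w\<^sup>2 < z\<^sup>2 - 4 * sqrt 3 / 9 * z"
    using w z by (intro square_minus_linear_gt) (simp_all add: power_mult_distrib power_divide)
  then show ?thesis
    by (simp add: le_ceiling_iff root3 w(2) flip: z_def)
qed

end
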